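(* Let $1\le I<N$ and $x\in[0,1)$, and suppose $I\le N-\sqrt{N+\frac54}+\frac12$. For each prefix $p$ of length $k$ (and, when $k>I$, $J$-statistic $j$) the following hold. When $k>I$, $\dot\Delta_J(k,j)\cdot\dot R_J(x)$ equals $$\sum_{J=1}^{j}\binom{N}{J-1}\frac{(N-J)!}{(k-J)!}\left(1-\sum_{i=k+1-J}^{N-J}\frac1i\right)x^{J-1}(1-x)^{I-(J-1)}.$$ When $k\le I$, $\dot\Delta_J(k)\cdot\dot R_J(x)$ (which does not depend on $j$) equals $$\sum_{J=1}^{I}\frac{1}{(k-1)!}\binom{N}{J-1}\frac{(N-J)!\,(I-1)!}{(I-J)!}\left(1-\sum_{i=k}^{I-1}\frac1i-\sum_{i=I+1-J}^{N-J}\frac1i\right)x^{J-1}(1-x)^{I-(J-1)}-\frac{1}{(k-1)!}\frac{N!}{I(N-I)}x^I.$$ In the one-step reselect game of best choice with parameters $N$, $I$, $x$, the following strategy is optimal (it maximizes the probability of winning among all strategies): reject candidates until a winnable prefix is encountered for which $\dot\Delta_J(k,j)\cdot\dot R_J(x)$ is positive (meaning $\ge 0$) for the first time; then accept the current candidate (at position $k$, where $k$ is the size of the prefix and $j$ its $J$-statistic).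
   Context: Permutations are written as words; $\pi_i$ is the value in position $i$. A bottom-to-top maximum of a permutation is an entry whose position is to the right of the positions of all entries with smaller value. For a permutation $\pi$ of size greater than $I$, the $J$-statistic $J(\pi)$ is the value of the next (leftmost) bottom-to-top maximum in a position greater than $I$; it lies in $\{1,\dots,I+1\}$. It is undefined for permutations of size at most $I$. The $i$th prefix flattening of $\pi$ is the permutation in $\mathfrak{S}_i$ with the same relative order as $\pi_1,\dots,\pi_i$. A prefix is an element of $\bigcup_{i=1}^N\mathfrak{S}_i$; a prefix of length $k$ is winnable if its entry in position $k$ is $k$. The game: $\pi\in\mathfrak{S}_N$ is chosen at random with probability $R_{J(\pi)}(x)$, where $R_J(x)=\frac{1}{N!(1-x)^{N-I}}\sum_{h=0}^{J-1}\binom Nh x^h(1-x)^{N-h}$. The prefix flattenings of $\pi$ of sizes $1,2,\dots,N$ are presented sequentially. After each one the player either accepts the current candidate (and stops) or rejects it (and continues); if no earlier candidate is accepted, the last one must be accepted. The player wins iff they stop at the position containing value $N$. $\dot R_J(x)=x^{J-1}(1-x)^{I-(J-1)}$ for $1\le J\le I+1$ (with $0^0=1$), and $f_J\cdot\dot R_J(x)$ denotes $\sum_{J=1}^{I+1}f_J\dot R_J(x)$. $\dot\Delta_J(k,j):=\dot\sigma_J(k)-\dot\tau^\circ_J(k)$ if $J\le j$ and $0$ if $J>j$; when $k\le I$ there is no dependence on $j$ and $\dot\Delta_J(k)=\dot\sigma_J(k)-\dot\tau^\circ_J(k)$ for all $1\le J\le I+1$. Here, for $k>I$: $\dot\sigma_J(k)=\binom{N}{J-1}\frac{(N-J)!}{(k-J)!}$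 and $\dot\tau^\circ_J(k)=\dot\sigma_J(k)\sum_{i=k-J+1}^{N-J}\frac1i$. For $k\le I$: $\dot\sigma_J(k)=\frac{1}{(k-1)!}\binom{N}{J-1}\frac{(N-J)!(I-1)!}{(I-J)!}$ if $J\le I$ and $\dot\sigma_{I+1}(k)=0$; $\dot\tau^\circ_J(I)=\binom{N}{J-1}\frac{(N-J)!}{(I-J)!}\sum_{i=I-J+1}^{N-J}\frac1i$ if $J\le I$ and $\dot\tau^\circ_{I+1}(I)=\frac{N!}{I!(N-I)}$; and $\dot\tau^\circ_J(k)=\frac{(I-1)!}{(k-1)!}\dot\tau^\circ_J(I)+\dot\sigma_J(k)\sum_{i=k}^{I-1}\frac1i$ for $k<I$. Empty sums are $0$. *)

theory Defs
  imports "HOL-Analysis.Analysis" "HOL-Combinatorics.Multiset_Permutations"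
begin

section \<open>Permutations, prefixes and the J-statistic\<close>

text \<open>
  Permutations of size n are words, i.e. elements of \<^term>\<open>permutations_of_set {1..n}\<close>.
  Positions are numbered from 1, whereas list indices start at 0.
\<close>

definition entry :: "nat list \<Rightarrow> nat \<Rightarrow> nat" where
  "entry w i = w ! (i - 1)"

definition flatten :: "nat list \<Rightarrow> nat list" where
  "flatten w = map (\<lambda>v. card {u \<in> set w. u \<le> v}) w"

definition prefix_flattening :: "nat \<Rightarrow> nat list \<Rightarrow> nat list" where
  "prefix_flattening i w = flatten (take i w)"

definition prefixes :: "nat \<Rightarrow> nat list set" where
  "prefixes N = (\<Union>k\<in>{1..N}. permutations_of_set {1..k})"

definition winnable :: "nat list \<Rightarrow> bool" where
  "winnable p \<longleftrightarrow> entry p (length p) = length p"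

definition btt_max :: "nat list \<Rightarrow> nat \<Rightarrow> bool" where
  "btt_max w i \<longleftrightarrow> i \<in> {1..length w} \<and>
     (\<forall>m\<in>{1..length w}. entry w m < entry w i \<longrightarrow> m < i)"

text \<open>Meaningful only if \<^term>\<open>I < length w\<close>; then the last position is a candidate
  for the least position below.\<close>

definition J_stat :: "nat \<Rightarrow> nat list \<Rightarrow> nat" where
  "J_stat I w = entry w (LEAST i. I < i \<and> btt_max w i)"


section \<open>The one-step reselect game\<close>

definition R_weight :: "nat \<Rightarrow> nat \<Rightarrow> nat \<Rightarrow> real \<Rightarrow> real" where
  "R_weight N I J x = 1 / (fact N * (1 - x) ^ (N - I)) *
     (\<Sum>h=0..J-1. real (N choose h) * x ^ h * (1 - x) ^ (N - h))"

definition game_measure :: "nat \<Rightarrow> nat \<Rightarrow> real \<Rightarrow> nat list measure" where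
  "game_measure N I x =
     point_measure (permutations_of_set {1..N}) (\<lambda>w. ennreal (R_weight N I (J_stat I w) x))"

text \<open>
  A strategy tells for every prefix flattening whether to accept the current candidate.
  The latest flattening determines all earlier ones, so it carries the entire history.
  Only the values of a strategy on \<^term>\<open>prefixes N\<close> matter.
\<close>

type_synonym strategy = "nat list \<Rightarrow> bool"

definition stop_position :: "nat \<Rightarrow> strategy \<Rightarrow> nat list \<Rightarrow> nat" where
  "stop_position N s w = (LEAST i. 1 \<le> i \<and> (i = N \<or> s (prefix_flattening i w)))"

definition wins :: "nat \<Rightarrow> strategy \<Rightarrow> nat list \<Rightarrow> bool" where
  "wins N s w \<longleftrightarrow> entry w (stop_position N s w) = N"

definition win_prob :: "nat \<Rightarrow> nat \<Rightarrow> real \<Rightarrow> strategy \<Rightarrow> real" where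
  "win_prob N I x s =
     measure (game_measure N I x) {w \<in> permutations_of_set {1..N}. wins N s w}"

definition optimal_strategy :: "nat \<Rightarrow> nat \<Rightarrow> real \<Rightarrow> strategy \<Rightarrow> bool" where
  "optimal_strategy N I x s \<longleftrightarrow> (\<forall>s'. win_prob N I x s' \<le> win_prob N I x s)"


section \<open>The coefficient vectors indexed by J\<close>

definition R_dot :: "nat \<Rightarrow> nat \<Rightarrow> real \<Rightarrow> real" where
  "R_dot I J x = x ^ (J - 1) * (1 - x) ^ (I - (J - 1))"

definition dot_R :: "nat \<Rightarrow> (nat \<Rightarrow> real) \<Rightarrow> real \<Rightarrow> real" where
  "dot_R I f x = (\<Sum>J=1..I+1. f J * R_dot I J x)"

definition sigma_dot :: "nat \<Rightarrow> nat \<Rightarrow> nat \<Rightarrow> nat \<Rightarrow> real" where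
  "sigma_dot N I k J =
     (if k > I then real (N choose (J - 1)) * (fact (N - J) / fact (k - J))
      else if J \<le> I then
        1 / fact (k - 1) * real (N choose (J - 1)) * (fact (N - J) * fact (I - 1) / fact (I - J))
      else 0)"

definition tau_circ_dot_at_I :: "nat \<Rightarrow> nat \<Rightarrow> nat \<Rightarrow> real" where
  "tau_circ_dot_at_I N I J =
     (if J \<le> I then
        real (N choose (J - 1)) * (fact (N - J) / fact (I - J)) * (\<Sum>i=I-J+1..N-J. 1 / real i)
      else fact N / (fact I * real (N - I)))"

definition tau_circ_dot :: "nat \<Rightarrow> nat \<Rightarrow> nat \<Rightarrow> nat \<Rightarrow> real" where
  "tau_circ_dot N I k J =
     (if k > I then sigma_dot N I k J * (\<Sum>i=k-J+1..N-J. 1 / real i)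
      else if k = I then tau_circ_dot_at_I N I J
      else fact (I - 1) / fact (k - 1) * tau_circ_dot_at_I N I J
           + sigma_dot N I k J * (\<Sum>i=k..I-1. 1 / real i))"

definition Delta_dot :: "nat \<Rightarrow> nat \<Rightarrow> nat \<Rightarrow> nat \<Rightarrow> nat \<Rightarrow> real" where
  "Delta_dot N I k j J =
     (if k > I \<and> J > j then 0 else sigma_dot N I k J - tau_circ_dot N I k J)"

end

theory Submission
  imports Defs
begin

text \<open>
  Arrange the prefixes in a tree: the children of a prefix of size \<open>k\<close> are the \<open>k + 1\<close> prefixes
  of size \<open>k + 1\<close> whose first \<open>k\<close> entries flatten to it. Up to the factor \<open>1 / N!\<close>, the pairings of
  \<open>\<sigma>\<close> and \<open>\<tau>\<close> with the vector \<^const>\<open>R_dot\<close> are the probabilities to meet a winnable prefix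
  and win by accepting the current candidate, respectively the next winnable one, since both satisfy the recursions of
  these probabilities along the tree. So the strategy of the theorem accepts when one step of
  waiting does not pay off. It is optimal because the condition \<open>\<tau> \<le> \<sigma>\<close> is inherited by
  children, winnable or not.

  For sizes below \<open>I\<close> inheritance is immediate from the recursions. For larger sizes, when \<open>k\<close> and
  \<open>J\<close> both increase by one, the \<open>J\<close>-th weight is multiplied by a quantity that decreases
  with \<open>J\<close> as soon as \<open>I \<le> (N - I)\<^sup>2\<close>, which is what the bound on \<open>I\<close> provides; as the summands
  change sign only once, a nonnegative sum remains nonnegative.
\<close>

section \<open>The tree of prefixes\<close>

text \<open>The appended entry is given by its relative value, so that winnability and the
  J-statistic of a child can be read off from \<open>v\<close> and \<open>p\<close>.\<close>

definition child :: "nat list \<Rightarrow> nat \<Rightarrow> nat list" where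
  "child p v = map (\<lambda>u. if v \<le> u then Suc u else u) p @ [v]"

definition extensions :: "nat \<Rightarrow> nat list \<Rightarrow> nat list set" where
  "extensions N p = {w \<in> permutations_of_set {1..N}. prefix_flattening (length p) w = p}"

lemma length_flatten [simp]: "length (flatten l) = length l"
  by (simp add: flatten_def)

lemma length_child [simp]: "length (child p v) = Suc (length p)"
  by (simp add: child_def)

section \<open>Flattening as replacement by ranks, and appending an entry\<close>

lemma perm_atLeastAtMostD:
  assumes "p \<in> permutations_of_set {1..k::nat}"
  shows "set p = {1..k}" "distinct p" "length p = k"
  using assms distinct_card[of p] by (auto simp: permutations_of_set_def)

lemma flatten_map:
  assumes "strict_mono_on (set m) f"
  shows "flatten (map f m) = flatten m"
proof -
  have inj: "inj_on f (set m)"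
    using assms strict_mono_on_imp_inj_on by blast
  have "card {u \<in> f ` set m. u \<le> f v} = card {u \<in> set m. u \<le> v}" if "v \<in> set m" for v
  proof -
    have "{u \<in> f ` set m. u \<le> f v} = f ` {u \<in> set m. u \<le> v}"
      using assms that by (auto simp: strict_mono_on_less_eq)
    moreover have "inj_on f {u \<in> set m. u \<le> v}"
      using inj by (rule inj_on_subset) auto
    ultimately show ?thesis by (simp add: card_image)
  qed
  then show ?thesis by (simp add: flatten_def)
qed

lemma flatten_perm:
  assumes "p \<in> permutations_of_set {1..k::nat}"
  shows "flatten p = p"
proof -
  have "card {u \<in> set p. u \<le> v} = v" if "v \<in> set p" for v
  proof -
    have "{u \<in> set p. u \<le> v} = {1..v}"
      using perm_atLeastAtMostD(1)[OF assms] that by auto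
    then show ?thesis by simp
  qed
  then show ?thesis by (simp add: flatten_def map_idI)
qed

text \<open>Passing to ranks is itself a strictly increasing relabelling, which a further flattening
  does not see. Hence a flattening determines all shorter ones.\<close>

lemma flatten_take_flatten: "flatten (take k (flatten l)) = flatten (take k l)"
proof -
  have "strict_mono_on (set l) (\<lambda>v. card {u \<in> set l. u \<le> v})"
  proof (rule strict_mono_onI)
    fix r s assume "r \<in> set l" "s \<in> set l" "r < s"
    then have "{u \<in> set l. u \<le> r} \<subseteq> {u \<in> set l. u \<le> s}"
      "s \<in> {u \<in> set l. u \<le> s} - {u \<in> set l. u \<le> r}" by auto
    then show "card {u \<in> set l. u \<le> r} < card {u \<in> set l. u \<le> s}"
      by (intro psubset_card_mono) (simp, blast)
  qed
  then have "strict_mono_on (set (take k l)) (\<lambda>v. card {u \<in> set l. u \<le> v})"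
    by (rule monotone_on_subset) (rule set_take_subset)
  from flatten_map[OF this] show ?thesis
    by (simp add: flatten_def[of l] take_map)
qed

lemma child_perm:
  assumes p: "p \<in> permutations_of_set {1..k::nat}" and v: "v \<in> {1..Suc k}"
  shows "child p v \<in> permutations_of_set {1..Suc k}"
proof -
  let ?f = "\<lambda>u. if v \<le> u then Suc u else u"
  note P = perm_atLeastAtMostD[OF p]
  \<comment> \<open>The shift leaves exactly the value \<open>v\<close> free: values below
    \<open>v\<close> are their own preimages, those above come from \<open>y - 1\<close>.\<close>
  have "?f ` {1..k} = {1..Suc k} - {v}"
  proof
    show "{1..Suc k} - {v} \<subseteq> ?f ` {1..k}"
    proof
      fix y assume y: "y \<in> {1..Suc k} - {v}"
      show "y \<in> ?f ` {1..k}"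
      proof (cases "y < v")
        case True
        then show ?thesis using y v by (intro image_eqI[of _ _ y]) auto
      next
        case False
        then show ?thesis using y v by (intro image_eqI[of _ _ "y - 1"]) auto
      qed
    qed
  qed (use v in auto)
  then have "set (child p v) = {1..Suc k}"
    using P v by (auto simp: child_def)
  moreover have "distinct (child p v)"
    using P by (auto simp: child_def distinct_map inj_on_def)
  ultimately show ?thesis by (simp add: permutations_of_set_def)
qed

lemma flatten_take_child:
  assumes "p \<in> permutations_of_set {1..k::nat}"
  shows "flatten (take k (child p v)) = p"
proof -
  have "strict_mono_on (set p) (\<lambda>u. if v \<le> u then Suc u else u)"
    by (auto simp: strict_mono_on_def)
  from flatten_map[OF this] show ?thesis
    using perm_atLeastAtMostD(3)[OF assms] flatten_perm[OF assms] by (simp add: child_def)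
qed

lemma winnable_child: "winnable (child p v) \<longleftrightarrow> v = Suc (length p)"
  by (simp add: winnable_def entry_def child_def nth_append)

text \<open>Appending \<open>a\<close> raises by one the ranks of exactly the letters above
  \<open>a\<close>. These are the letters whose old rank exceeds the number of letters below
  \<open>a\<close>, which is the test made by \<open>child\<close>.\<close>

lemma flatten_snoc:
  assumes "distinct (l @ [a])"
  shows "flatten (l @ [a]) = child (flatten l) (Suc (card {u \<in> set l. u < a}))"
proof -
  let ?c = "\<lambda>v. card {u \<in> set l. u \<le> v}" and ?v = "Suc (card {u \<in> set l. u < a})"
  have a: "a \<notin> set l" using assms by simp
  have "card {u \<in> set (l @ [a]). u \<le> y} = (if ?v \<le> ?c y then Suc (?c y) else ?c y)"
    if y: "y \<in> set l" for y
  proof (cases "a < y")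
    case True
    then have "{u \<in> set (l @ [a]). u \<le> y} = insert a {u \<in> set l. u \<le> y}" by auto
    then have 1: "card {u \<in> set (l @ [a]). u \<le> y} = Suc (?c y)" using a by simp
    have "{u \<in> set l. u < a} \<subseteq> {u \<in> set l. u \<le> y}"
      "y \<in> {u \<in> set l. u \<le> y} - {u \<in> set l. u < a}" using True y by auto
    then have "card {u \<in> set l. u < a} < ?c y"
      by (intro psubset_card_mono) (simp, blast)
    then show ?thesis using 1 by simp
  next
    case False
    then have lt: "y < a" using a y by (metis linorder_neqE_nat)
    then have "{u \<in> set (l @ [a]). u \<le> y} = {u \<in> set l. u \<le> y}" by auto
    moreover have "?c y \<le> card {u \<in> set l. u < a}"
      using lt by (intro card_mono) auto
    ultimately show ?thesis by simp
  qed
  moreover have "card {u \<in> set (l @ [a]). u \<le> a} = ?v"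
  proof -
    have "{u \<in> set (l @ [a]). u \<le> a} = insert a {u \<in> set l. u < a}" using a by auto
    then show ?thesis using a by simp
  qed
  ultimately show ?thesis by (simp add: flatten_def child_def)
qed

section \<open>Full permutations extending a prefix\<close>

lemma extensions_child:
  assumes p: "p \<in> permutations_of_set {1..k}" and k: "k < N"
  shows "extensions N p = (\<Union>v\<in>{1..Suc k}. extensions N (child p v))"
proof
  note P = perm_atLeastAtMostD[OF p]
  show "extensions N p \<subseteq> (\<Union>v\<in>{1..Suc k}. extensions N (child p v))"
  proof
    fix w assume "w \<in> extensions N p"
    then have w: "w \<in> permutations_of_set {1..N}" and wp: "flatten (take k w) = p"
      using P by (auto simp: extensions_def prefix_flattening_def)
    note W = perm_atLeastAtMostD[OF w]
    have tk: "take (Suc k) w = take k w @ [w ! k]"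
      using W k by (simp add: take_Suc_conv_app_nth)
    let ?v = "Suc (card {u \<in> set (take k w). u < w ! k})"
    have d: "distinct (take k w @ [w ! k])"
      using W(2) tk by (metis distinct_take)
    have "card {u \<in> set (take k w). u < w ! k} \<le> card (set (take k w))"
      by (intro card_mono) auto
    also have "\<dots> \<le> k" using card_length[of "take k w"] by simp
    finally have "?v \<in> {1..Suc k}" by simp
    moreover have "w \<in> extensions N (child p ?v)"
      using flatten_snoc[OF d] w wp P tk by (simp add: extensions_def prefix_flattening_def)
    ultimately show "w \<in> (\<Union>v\<in>{1..Suc k}. extensions N (child p v))" by blast
  qed
  show "(\<Union>v\<in>{1..Suc k}. extensions N (child p v)) \<subseteq> extensions N p"
  proof safe
    fix v w assume "w \<in> extensions N (child p v)"
    then have w: "w \<in> permutations_of_set {1..N}" and wp: "flatten (take (Suc k) w) = child p v"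
      using P by (auto simp: extensions_def prefix_flattening_def)
    have "flatten (take k w) = flatten (take k (flatten (take (Suc k) w)))"
      by (simp add: flatten_take_flatten min_def)
    also have "\<dots> = p" using flatten_take_child[OF p] by (simp add: wp)
    finally show "w \<in> extensions N p" using w P by (simp add: extensions_def prefix_flattening_def)
  qed
qed

lemma finite_extensions: "finite (extensions N p)"
  by (simp add: extensions_def)

lemma sum_extensions_child:
  assumes "p \<in> permutations_of_set {1..k}" "k < N"
  shows "sum f (extensions N p) = (\<Sum>v=1..Suc k. sum f (extensions N (child p v)))"
  unfolding extensions_child[OF assms]
proof (rule sum.UNION_disjoint)
  \<comment> \<open>The last entry of a child recovers \<open>v\<close>, and a word has only one
    flattening of size \<open>Suc k\<close>.\<close>
  show "\<forall>i\<in>{1..Suc k}. \<forall>j\<in>{1..Suc k}. i \<noteq> j \<longrightarrow>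
      extensions N (child p i) \<inter> extensions N (child p j) = {}"
    by (auto simp: extensions_def child_def)
qed (auto simp: finite_extensions)

lemma extensions_full:
  assumes "p \<in> permutations_of_set {1..N}"
  shows "extensions N p = {p}"
proof -
  have "prefix_flattening N w = w" if "w \<in> permutations_of_set {1..N}" for w
    using flatten_perm[OF that] perm_atLeastAtMostD(3)[OF that]
    by (simp add: prefix_flattening_def)
  then show ?thesis
    using assms perm_atLeastAtMostD(3)[OF assms] by (auto simp: extensions_def)
qed

lemma extensions_singleton:
  assumes "1 \<le> N"
  shows "extensions N [1] = permutations_of_set {1..N}"
proof -
  have "prefix_flattening (Suc 0) w = [Suc 0]" if "w \<in> permutations_of_set {1..N}" for w
  proof -
    have "length w = N" using that by (rule perm_atLeastAtMostD(3))
    then obtain a l where "w = a # l" using assms by (cases w) auto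
    moreover have "{u. u = a \<and> u \<le> a} = {a}" by auto
    ultimately show ?thesis by (simp add: prefix_flattening_def flatten_def)
  qed
  then show ?thesis by (auto simp: extensions_def)
qed

text \<open>Backward induction along the tree, from the full permutations as leaves towards the
  root.\<close>

lemma prefix_induct [consumes 3, case_names full step]:
  assumes "p \<in> permutations_of_set {1..k}" "1 \<le> k" "k \<le> N"
    and full: "\<And>p. p \<in> permutations_of_set {1..N} \<Longrightarrow> P p"
    and step: "\<And>k p. 1 \<le> k \<Longrightarrow> k < N \<Longrightarrow> p \<in> permutations_of_set {1..k} \<Longrightarrow>
      (\<And>v. v \<in> {1..Suc k} \<Longrightarrow> P (child p v)) \<Longrightarrow> P p"
  shows "P p"
  using \<open>k \<le> N\<close> \<open>1 \<le> k\<close> \<open>p \<in> permutations_of_set {1..k}\<close>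
proof (induction arbitrary: p rule: inc_induct)
  case base
  then show ?case by (simp add: full)
next
  case (step m)
  show ?case
  proof (rule assms(5)[of m])
    show "P (child p v)" if "v \<in> {1..Suc m}" for v
      using step.IH[OF _ child_perm[OF step.prems(2) that]] by simp
  qed (use step in auto)
qed

section \<open>The J-statistic and its change along the tree\<close>

text \<open>All entries smaller than the minimum beyond position \<open>I\<close> sit at positions
  up to \<open>I\<close>, so it is a bottom-to-top maximum. A position between \<open>I\<close> and
  that of the minimum is none, having the smaller minimum to its right.\<close>

lemma J_stat_eq_Min:
  assumes d: "distinct w" and I: "I < length w"
  shows "J_stat I w = Min (set (drop I w))"
proof -
  have ne: "set (drop I w) \<noteq> {}" using I by simp
  from Min_in[OF _ ne] obtain n where n: "n < length w - I" "drop I w ! n = Min (set (drop I w))"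
    by (auto simp: in_set_conv_nth)
  define m where "m = Suc (I + n)"
  have m: "I < m" "m \<le> length w" "entry w m = Min (set (drop I w))"
    using n I by (auto simp: m_def entry_def)
  have le: "entry w m \<le> entry w i" if "I < i" "i \<le> length w" for i
  proof -
    have "entry w i = drop I w ! (i - Suc I)" using that by (simp add: entry_def)
    also have "\<dots> \<in> set (drop I w)" using that by (intro nth_mem) auto
    finally show ?thesis using m by simp
  qed
  have inj: "i = i'" if "entry w i = entry w i'" "i \<in> {1..length w}" "i' \<in> {1..length w}" for i i'
  proof -
    have "i - 1 < length w" "i' - 1 < length w" using that by auto
    then have "i - 1 = i' - 1" using that(1) d by (simp add: entry_def nth_eq_iff_index_eq)
    then show ?thesis using that by auto
  qed
  have "(LEAST i. I < i \<and> btt_max w i) = m"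
  proof (rule Least_equality)
    show "I < m \<and> btt_max w m"
      unfolding btt_max_def
    proof (intro conjI ballI impI)
      fix i assume i: "i \<in> {1..length w}" "entry w i < entry w m"
      show "i < m"
      proof (rule ccontr)
        assume "\<not> i < m"
        with m(1) i(1) have "entry w m \<le> entry w i" by (intro le) auto
        with i(2) show False by simp
      qed
    qed (use m in auto)
  next
    fix i assume i: "I < i \<and> btt_max w i"
    then have "i \<in> {1..length w}" by (simp add: btt_max_def)
    show "m \<le> i"
    proof (rule ccontr)
      assume "\<not> m \<le> i"
      then have "i < m" by simp
      have mI: "m \<in> {1..length w}" using m by simp
      have "entry w m \<noteq> entry w i"
        using inj[OF _ mI \<open>i \<in> {1..length w}\<close>] \<open>i < m\<close> by blast
      moreover have "entry w m \<le> entry w i"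
        using i \<open>i \<in> {1..length w}\<close> by (intro le) auto
      ultimately have "entry w m < entry w i" by simp
      then have "m < i" using i mI unfolding btt_max_def by blast
      then show False using \<open>i < m\<close> by simp
    qed
  qed
  then show ?thesis using m by (simp add: J_stat_def)
qed

lemma J_stat_bounds:
  assumes p: "p \<in> permutations_of_set {1..k}" and k: "I < k"
  shows "1 \<le> J_stat I p" "J_stat I p \<le> Suc I"
proof -
  note P = perm_atLeastAtMostD[OF p]
  have eq: "J_stat I p = Min (set (drop I p))"
    using P k by (intro J_stat_eq_Min) auto
  have ne: "set (drop I p) \<noteq> {}" using P k by simp
  have "Min (set (drop I p)) \<in> {1..k}"
    using Min_in[OF _ ne] set_drop_subset[of I p] P by auto
  then show "1 \<le> J_stat I p" using eq by simp
  \<comment> \<open>Pigeonhole: the \<open>k - I\<close> entries beyond position \<open>I\<close>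
    have to fit between their minimum and \<open>k\<close>.\<close>
  have "card (set (drop I p)) \<le> card {J_stat I p..k}"
    using set_drop_subset[of I p] P by (intro card_mono) (auto simp: eq)
  moreover have "card (set (drop I p)) = k - I"
    using P by (simp add: distinct_card)
  ultimately show "J_stat I p \<le> Suc I" using k by auto
qed

text \<open>The shift raises the old minimum only if that is at least \<open>v\<close>, and then
  \<open>v\<close> is the new minimum. For \<open>k = I\<close> the entry \<open>v\<close> is the
  only one beyond position \<open>I\<close>.\<close>

lemma J_stat_child:
  assumes p: "p \<in> permutations_of_set {1..k}" and k: "I \<le> k" and v: "v \<in> {1..Suc k}"
  shows "J_stat I (child p v) = (if k = I then v else min (J_stat I p) v)"
proof -
  note P = perm_atLeastAtMostD[OF p]
  have eq: "J_stat I (child p v) = Min (set (drop I (child p v)))"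
    using perm_atLeastAtMostD[OF child_perm[OF p v]] k by (intro J_stat_eq_Min) auto
  define f where "f = (\<lambda>u. if v \<le> u then Suc u else u)"
  have s: "set (drop I (child p v)) = insert v (f ` set (drop I p))"
    using P k by (auto simp: child_def drop_map f_def)
  show ?thesis
  proof (cases "k = I")
    case True
    then show ?thesis using eq s P by simp
  next
    case False
    then have ne: "set (drop I p) \<noteq> {}" and I: "I < k" using P k by auto
    have "mono f" by (auto simp: mono_def f_def)
    then have "f (Min (set (drop I p))) = Min (f ` set (drop I p))"
      using ne by (intro mono_Min_commute) auto
    moreover have "J_stat I p = Min (set (drop I p))"
      using P I by (intro J_stat_eq_Min) auto
    ultimately have "J_stat I (child p v) = min v (f (J_stat I p))"
      using eq s ne by simp
    then show ?thesis using False by (auto simp: f_def)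
  qed
qed


section \<open>Monotonicity of the one-step comparison\<close>

text \<open>A Chebyshev-type argument. Let \<open>K\<close> be the last index with
  \<open>g K\<close> nonnegative. The factor \<open>r\<close> is at least \<open>r K\<close> on the
  nonnegative terms and at most \<open>r K\<close> on the others, so the new sum is at least
  \<open>r K\<close> times the old one.\<close>

lemma sum_mult_antimono_nonneg:
  fixes a r g :: "nat \<Rightarrow> real"
  assumes fin: "finite A"
    and a: "\<And>i. i \<in> A \<Longrightarrow> 0 \<le> a i" and r: "\<And>i. i \<in> A \<Longrightarrow> 0 \<le> r i"
    and r_anti: "antimono_on A r" and g_anti: "antimono_on A g"
    and nonneg: "0 \<le> (\<Sum>i\<in>A. a i * g i)"
  shows "0 \<le> (\<Sum>i\<in>A. r i * (a i * g i))"
proof (cases "\<exists>i\<in>A. 0 \<le> g i")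
  case False
  \<comment> \<open>If \<open>g\<close> is negative throughout, a nonnegative sum forces every term
    to vanish.\<close>
  then have le: "a i * g i \<le> 0" if "i \<in> A" for i
    using a[OF that] that by (auto intro!: mult_nonneg_nonpos simp: not_le intro: less_imp_le)
  then have "(\<Sum>i\<in>A. - (a i * g i)) = 0"
    using nonneg sum_nonpos[of A "\<lambda>i. a i * g i"] by (simp add: sum_negf)
  then have "\<forall>i\<in>A. - (a i * g i) = 0"
    using le fin by (subst (asm) sum_nonneg_eq_0_iff) auto
  then have "(\<Sum>i\<in>A. r i * (a i * g i)) = 0"
    by (intro sum.neutral) auto
  then show ?thesis by simp
next
  case True
  define K where "K = Max {i \<in> A. 0 \<le> g i}"
  have "K \<in> {i \<in> A. 0 \<le> g i}"
    unfolding K_def using True fin by (intro Max_in) auto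
  then have K: "K \<in> A" "0 \<le> g K" by auto
  have K_max: "g i < 0" if "i \<in> A" "K < i" for i
  proof (rule ccontr)
    assume "\<not> g i < 0"
    with that fin have "i \<le> K" unfolding K_def by (intro Max_ge) auto
    with that show False by simp
  qed
  have "r K * (a i * g i) \<le> r i * (a i * g i)" if i: "i \<in> A" for i
  proof (cases "i \<le> K")
    case True
    then have "g K \<le> g i" "r K \<le> r i"
      using g_anti r_anti i K by (auto simp: monotone_on_def)
    then show ?thesis using K a[OF i] by (intro mult_right_mono) auto
  next
    case False
    then have "r i \<le> r K" using r_anti i K by (auto simp: monotone_on_def)
    moreover have "a i * g i \<le> 0"
      using K_max[of i] False i a[OF i] by (intro mult_nonneg_nonpos) auto
    ultimately show ?thesis by (rule mult_right_mono_neg)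
  qed
  then have "(\<Sum>i\<in>A. r K * (a i * g i)) \<le> (\<Sum>i\<in>A. r i * (a i * g i))"
    by (rule sum_mono)
  moreover have "0 \<le> r K * (\<Sum>i\<in>A. a i * g i)"
    using r K nonneg by simp
  ultimately show ?thesis by (simp add: sum_distrib_left)
qed

text \<open>The J-th summand in the pairing of \<open>sigma_dot\<close> with \<open>R_dot\<close>
  for \<open>k > I\<close>; also for \<open>k = I\<close> and \<open>J \<le> I\<close>, where
  \<open>fact (I - 1)\<close> cancels.\<close>

definition J_weight :: "nat \<Rightarrow> nat \<Rightarrow> real \<Rightarrow> nat \<Rightarrow> nat \<Rightarrow> real" where
  "J_weight N I x k J = real (N choose (J - 1)) * (fact (N - J) / fact (k - J)) * R_dot I J x"

text \<open>The factor \<open>1 - \<tau> / \<sigma>\<close> by which a summand of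
  \<open>\<sigma>\<close> becomes one of \<open>\<sigma> - \<tau>\<close>.\<close>

definition gain :: "nat \<Rightarrow> nat \<Rightarrow> nat \<Rightarrow> real" where
  "gain N k J = 1 - (\<Sum>i=k+1-J..N-J. 1 / real i)"

lemma R_dot_nonneg: "0 \<le> x \<Longrightarrow> x < 1 \<Longrightarrow> 0 \<le> R_dot I J x"
  by (simp add: R_dot_def)

lemma J_weight_nonneg: "0 \<le> x \<Longrightarrow> x < 1 \<Longrightarrow> 0 \<le> J_weight N I x k J"
  by (simp add: J_weight_def R_dot_nonneg)

text \<open>The joint shift keeps \<open>k - J\<close>. The binomial coefficient contributes
  \<open>(N - J + 1) / J\<close>, the factorial \<open>1 / (N - J)\<close>, and \<open>R_dot\<close>
  contributes \<open>x / (1 - x)\<close>.\<close>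

lemma J_weight_Suc:
  assumes "1 \<le> J" "J \<le> I" "I < N" "J \<le> k" "x < 1"
  shows "J_weight N I x (Suc k) (Suc J) =
    x / (1 - x) * (real (N - J + 1) / (real J * real (N - J))) * J_weight N I x k J"
proof -
  obtain i where J: "J = Suc i" using assms by (cases J) auto
  have "Suc i * (N choose Suc i) = (N - i) * (N choose i)"
    by (metis binomial_absorb_comp binomial_absorption mult.commute)
  then have "real (Suc i) * real (N choose Suc i) = real (N - i) * real (N choose i)"
    by (metis of_nat_mult)
  then have c: "real (N choose Suc i) = real (N - i) * real (N choose i) / real (Suc i)"
    by (simp add: field_simps del: of_nat_Suc)
  obtain n where n: "N - J = Suc n" "N - Suc J = n" using assms by (metis Suc_diff_Suc le_less_trans)
  have ni: "N - i = Suc (Suc n)" using n J assms by linarith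
  obtain m where m: "I - i = Suc m" "I - Suc i = m" using assms J by (metis Suc_diff_Suc Suc_le_lessD)
  have "1 - x \<noteq> 0" using assms by simp
  then show ?thesis
    using assms unfolding J_weight_def R_dot_def
    by (simp add: J c n[unfolded J] m ni divide_simps del: of_nat_Suc)
qed

text \<open>Re-indexing makes the number of terms independent of \<open>J\<close>; only the
  denominators still depend on \<open>J\<close>, so monotonicity in \<open>J\<close> can be checked
  termwise.\<close>

lemma gain_Suc_eq:
  assumes "J \<le> k" "k \<le> N"
  shows "gain N k J = 1 - (\<Sum>t=1..N-k. 1 / (real t + real (k - J)))"
proof -
  have "{k+1-J..N-J} = {1+(k-J)..(N-k)+(k-J)}" using assms by auto
  then show ?thesis
    by (simp only: gain_def sum.shift_bounds_cl_nat_ivl) (simp add: add_ac)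
qed

lemma gain_antimono:
  assumes "k \<le> N"
  shows "antimono_on {..k} (gain N k)"
proof (rule monotone_onI)
  fix J J' assume J: "J \<in> {..k}" "J' \<in> {..k}" "J \<le> J'"
  have "(\<Sum>t=1..N-k. 1 / (real t + real (k - J))) \<le> (\<Sum>t=1..N-k. 1 / (real t + real (k - J')))"
    using J by (intro sum_mono divide_left_mono) auto
  then show "gain N k J' \<le> gain N k J" using J assms by (simp add: gain_Suc_eq)
qed

text \<open>The joint shift keeps the lower limit of the harmonic sum and lowers the upper
  one.\<close>

lemma gain_le_Suc: "gain N k J \<le> gain N (Suc k) (Suc J)"
  unfolding gain_def by (simp, intro sum_mono2) auto

text \<open>This is where the bound on \<open>I\<close> enters. With \<open>n = N - J'\<close> and
  \<open>d = J' - J\<close>, cross-multiplication leaves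
  \<open>0 \<le> d * (n^2 + n * d + n - J)\<close>, and
  \<open>J \<le> I \<le> (N - I)^2 \<le> n^2\<close>.\<close>

lemma shift_ratio_antimono:
  assumes "I < N" "I \<le> (N - I)^2"
  shows "antimono_on {1..I} (\<lambda>J. real (N - J + 1) / (real J * real (N - J)))"
proof (rule monotone_onI)
  fix J J' assume J: "J \<in> {1..I}" "J' \<in> {1..I}" "J \<le> J'"
  have cross: "a / b \<le> c / e" if "a * e \<le> c * b" "0 < b" "0 < e" for a b c e :: real
    using that by (simp add: field_simps)
  define n d where "n = N - J'" and "d = J' - J"
  have J': "J' = J + d" and NJ: "N - J = n + d" "N - (J + d) = n" and n0: "0 < n" and J0: "0 < J"
    using J assms by (auto simp: n_def d_def)
  have "J \<le> (N - I)^2" using assms J by auto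
  also have "\<dots> \<le> n^2" using J by (intro power_mono) (auto simp: n_def)
  finally have "real J \<le> (real n)^2" by (metis of_nat_le_iff of_nat_power)
  moreover have "0 \<le> real n * real d" by simp
  ultimately have "0 \<le> (real n)^2 + real n * real d + real n - real J" by linarith
  then have "0 \<le> real d * ((real n)^2 + real n * real d + real n - real J)" by simp
  then have "(real n + 1) * (real J * (real n + real d)) \<le>
      (real n + real d + 1) * ((real J + real d) * real n)"
    by (simp add: algebra_simps power2_eq_square)
  then show "real (N - J' + 1) / (real J' * real (N - J')) \<le> real (N - J + 1) / (real J * real (N - J))"
    using n0 J0 by (intro cross) (simp_all add: NJ J' add_ac)
qed

text \<open>Inheritance along one edge for sizes at least \<open>I\<close>: \<open>m\<close> is the
  cut-off of the parent and \<open>j\<close> that of the child. The terms \<open>2..j\<close> of the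
  child arise from terms of the parent by the joint shift of \<open>k\<close> and
  \<open>J\<close>.\<close>

lemma sum_J_weight_gain_Suc:
  assumes N: "I < N" "I \<le> (N - I)^2" and x: "0 \<le> x" "x < 1"
    and k: "k < N" and m: "1 \<le> m" "m \<le> k"
    and j: "1 \<le> j" "j \<le> m + 1" "j \<le> I + 1"
    and nonneg: "0 \<le> (\<Sum>J=1..m. J_weight N I x k J * gain N k J)"
  shows "0 \<le> (\<Sum>J=1..j. J_weight N I x (Suc k) J * gain N (Suc k) J)"
proof -
  define a g where "a = J_weight N I x k" and "g = (\<lambda>J. gain N (Suc k) (Suc J))"
  \<comment> \<open>Cutting the ratio off to zero accounts for the cut-off of the child and keeps
    \<open>r\<close> decreasing. The cut is at \<open>J < j\<close> because \<open>J\<close>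
    corresponds to the index \<open>Suc J\<close> of the child.\<close>
  define r where "r = (\<lambda>J. if J < j then x / (1 - x) * (real (N - J + 1) / (real J * real (N - J))) else 0)"
  have a: "0 \<le> a J" for J using x by (simp add: a_def J_weight_nonneg)
  have "(\<Sum>J=1..m. a J * gain N k J) \<le> (\<Sum>J=1..m. a J * g J)"
    using a by (intro sum_mono mult_left_mono) (simp_all add: g_def gain_le_Suc)
  with nonneg have ag: "0 \<le> (\<Sum>J=1..m. a J * g J)" by (simp add: a_def)
  have g_anti: "antimono_on {1..m} g"
    using gain_antimono[of "Suc k" N] k m by (auto simp: monotone_on_def g_def)
  have r_anti: "antimono_on {1..m} r"
  proof (rule monotone_onI)
    fix J J' assume J: "J \<in> {1..m}" "J' \<in> {1..m}" "J \<le> J'"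
    show "r J' \<le> r J"
    proof (cases "J' < j")
      case True
      then have "J \<in> {1..I}" "J' \<in> {1..I}" using J j by auto
      then have "real (N - J' + 1) / (real J' * real (N - J')) \<le> real (N - J + 1) / (real J * real (N - J))"
        using monotone_onD[OF shift_ratio_antimono[OF N]] J(3) by blast
      moreover have "J < j" "0 \<le> x / (1 - x)" using True J x by auto
      ultimately show ?thesis
        unfolding r_def using True by (simp only: if_True mult_left_mono)
    next
      case False
      then show ?thesis using x by (simp add: r_def)
    qed
  qed
  have "0 \<le> (\<Sum>J=1..m. r J * (a J * g J))"
    using a x by (intro sum_mult_antimono_nonneg r_anti g_anti ag) (auto simp: r_def)
  also have "\<dots> = (\<Sum>J=1..<j. r J * (a J * g J))"
    using j by (intro sum.mono_neutral_right) (auto simp: r_def)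
  also have "\<dots> = (\<Sum>J=1..<j. J_weight N I x (Suc k) (Suc J) * gain N (Suc k) (Suc J))"
  proof (rule sum.cong)
    fix J assume "J \<in> {1..<j}"
    then show "r J * (a J * g J) = J_weight N I x (Suc k) (Suc J) * gain N (Suc k) (Suc J)"
      using J_weight_Suc[of J I N k x] j m N x by (simp add: r_def a_def g_def)
  qed simp
  also have "\<dots> = (\<Sum>J=2..j. J_weight N I x (Suc k) J * gain N (Suc k) J)"
  proof -
    have "{2..j} = {Suc 1..<Suc j}" by auto
    then show ?thesis by (simp only: sum.shift_bounds_Suc_ivl)
  qed
  finally have tail: "0 \<le> (\<Sum>J=2..j. J_weight N I x (Suc k) J * gain N (Suc k) J)" .
  \<comment> \<open>The term \<open>J = 1\<close> of the child does not arise from the shift. Its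
    gain is at least that of \<open>J = 2\<close>, which is \<open>g 1\<close>; were
    \<open>g 1\<close> negative, all \<open>g\<close> would be, and as \<open>a 1 > 0\<close> the
    sum would be negative.\<close>
  have "0 \<le> g 1"
  proof (rule ccontr)
    assume neg: "\<not> 0 \<le> g 1"
    have gJ: "g J < 0" if "J \<in> {1..m}" for J
      using g_anti that neg m unfolding monotone_on_def by (metis atLeastAtMost_iff le_less_trans not_le order_refl)
    have "a 1 > 0"
      using x by (simp add: a_def J_weight_def R_dot_def)
    have "(\<Sum>J=1..m. a J * g J) < (\<Sum>J=1..m. 0)"
    proof (rule sum_strict_mono_ex1)
      show "\<forall>J\<in>{1..m}. a J * g J \<le> 0"
        by (intro ballI mult_nonneg_nonpos a less_imp_le[OF gJ])
      show "\<exists>J\<in>{1..m}. a J * g J < 0"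
        using \<open>a 1 > 0\<close> neg m by (intro bexI[of _ 1]) (auto intro!: mult_pos_neg)
    qed simp
    with ag show False by simp
  qed
  then have "0 \<le> gain N (Suc k) 1"
    using monotone_onD[OF gain_antimono[of "Suc k" N], of 1 "Suc 1"] k m by (simp add: g_def)
  then have "0 \<le> J_weight N I x (Suc k) 1 * gain N (Suc k) 1"
    using x by (simp add: J_weight_nonneg)
  with tail show ?thesis
    using j by (subst sum.atLeast_Suc_atMost) (simp_all add: numeral_2_eq_2)
qed

section \<open>Recursions of the coefficient vectors in the prefix size\<close>

definition truncated :: "nat \<Rightarrow> real \<Rightarrow> (nat \<Rightarrow> nat \<Rightarrow> real) \<Rightarrow> nat \<Rightarrow> nat \<Rightarrow> real" where
  "truncated I x f k j = dot_R I (\<lambda>J. if k > I \<and> J > j then 0 else f k J) x"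

text \<open>For a prefix of size \<^term>\<open>k\<close>, the number of non-winnable children whose J-statistic is at
  least \<^term>\<open>J\<close>, if that of the prefix is; all of them count while the J-statistic of the
  children is undefined.\<close>

definition child_mult :: "nat \<Rightarrow> nat \<Rightarrow> nat \<Rightarrow> real" where
  "child_mult I k J = (if k < I then real k else real (k + 1 - J))"

lemma dot_R_Delta_dot:
  "dot_R I (Delta_dot N I k j) x =
     truncated I x (sigma_dot N I) k j - truncated I x (tau_circ_dot N I) k j"
  unfolding dot_R_def truncated_def sum_subtractf[symmetric]
  by (intro sum.cong) (auto simp: Delta_dot_def left_diff_distrib)

lemma sigma_dot_Suc:
  assumes "1 \<le> k" "k < N" "1 \<le> J" "J \<le> I + 1" "1 \<le> I" "I < N"
  shows "sigma_dot N I k J = child_mult I k J * sigma_dot N I (Suc k) J"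
proof (cases "I \<le> k")
  case True
  show ?thesis
  proof (cases "J \<le> k")
    case True
    then obtain m where "k = J + m" by (metis le_add_diff_inverse)
    then show ?thesis
      using assms \<open>I \<le> k\<close> by (auto simp: sigma_dot_def child_mult_def Suc_diff_le simp del: of_nat_Suc)
  next
    case False
    \<comment> \<open>Only \<open>k = I\<close>, \<open>J = I + 1\<close> is left, where
      \<open>sigma_dot\<close> and the multiplier are both zero.\<close>
    then show ?thesis using assms \<open>I \<le> k\<close> by (auto simp: sigma_dot_def child_mult_def)
  qed
next
  case False
  have "(fact k :: real) = real k * fact (k - 1)" using assms by (simp add: fact_reduce)
  then show ?thesis using assms False by (auto simp: sigma_dot_def child_mult_def)
qed

text \<open>The first summand belongs to the winnable child, the second to the others. The harmonic
  sum loses its first term, \<open>1 / (k - J + 1)\<close> or, for \<open>k < I\<close>,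
  \<open>1 / k\<close>; multiplied by \<open>sigma_dot N I k J\<close> this is
  \<open>sigma_dot N I (Suc k) J\<close>.\<close>

lemma tau_circ_dot_Suc:
  assumes "1 \<le> k" "k < N" "1 \<le> J" "J \<le> I + 1" "1 \<le> I" "I < N"
  shows "tau_circ_dot N I k J = sigma_dot N I (Suc k) J + child_mult I k J * tau_circ_dot N I (Suc k) J"
proof (cases "I \<le> k")
  case True
  show ?thesis
  proof (cases "J \<le> k")
    case True
    then have eq: "Suc k - J = Suc (k - J)" by simp
    have h: "(\<Sum>i=k-J+1..N-J. 1 / real i) = 1 / real (Suc (k - J)) + (\<Sum>i=Suc k-J+1..N-J. 1 / real i)"
      using True assms by (subst sum.atLeast_Suc_atMost) (auto simp: eq)
    have "tau_circ_dot N I k J =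
        real (N choose (J - 1)) * (fact (N - J) / fact (k - J)) * (\<Sum>i=k-J+1..N-J. 1 / real i)"
      using assms True \<open>I \<le> k\<close> by (auto simp: tau_circ_dot_def tau_circ_dot_at_I_def sigma_dot_def)
    moreover have "tau_circ_dot N I (Suc k) J = real (N choose (J - 1)) * (fact (N - J) / fact (Suc k - J)) *
        (\<Sum>i=Suc k-J+1..N-J. 1 / real i)"
      using \<open>I \<le> k\<close> by (simp add: tau_circ_dot_def sigma_dot_def)
    moreover have "sigma_dot N I (Suc k) J = real (N choose (J - 1)) * (fact (N - J) / fact (Suc k - J))"
      using \<open>I \<le> k\<close> by (simp add: sigma_dot_def)
    moreover have "child_mult I k J = real (Suc (k - J))"
      using \<open>I \<le> k\<close> True by (simp add: child_mult_def Suc_diff_le)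
    moreover have "B * (F / f) * (1 / s + H) = B * (F / (s * f)) + s * (B * (F / (s * f)) * H)"
      if "s \<noteq> 0" "f \<noteq> 0" for B F f s H :: real
      using that by (simp add: field_simps)
    ultimately show ?thesis
      unfolding h eq fact_Suc by simp
  next
    case False
    \<comment> \<open>Here the multiplier is zero, and the special value of
      \<open>tau_circ_dot_at_I\<close> at \<open>I + 1\<close> is just
      \<open>sigma_dot N I (Suc I) (I + 1)\<close>.\<close>
    then have "k = I" "J = I + 1" using assms \<open>I \<le> k\<close> by auto
    moreover have "real (N choose I) * fact (N - Suc I) = fact N / (fact I * real (N - I))"
    proof -
      obtain n where "N - I = Suc n" "N - Suc I = n" using assms by (metis Suc_diff_Suc)
      then show ?thesis using assms by (simp add: binomial_fact del: of_nat_Suc)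
    qed
    ultimately show ?thesis
      using assms by (auto simp: sigma_dot_def child_mult_def tau_circ_dot_def tau_circ_dot_at_I_def)
  qed
next
  case False
  then obtain i where i: "k = Suc i" using assms by (cases k) auto
  have *: "(\<Sum>i=k..I - 1. 1 / real i) = 1 / real k + (\<Sum>i=Suc k..I - 1. 1 / real i)"
    using False by (subst sum.atLeast_Suc_atMost) auto
  have s: "sigma_dot N I k J = real k * sigma_dot N I (Suc k) J"
    using sigma_dot_Suc[OF assms] False by (simp add: child_mult_def)
  show ?thesis
  proof (cases "Suc k = I")
    case True
    then have "I - 1 = k" by simp
    then have "(fact (I - 1) :: real) = real k * fact (k - 1)" using i by simp
    then show ?thesis using False True * s assms i
      by (simp add: tau_circ_dot_def child_mult_def del: fact_Suc of_nat_Suc)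
  next
    case neq: False
    have f: "(fact k :: real) = real k * fact (k - 1)" using i by simp
    have "tau_circ_dot N I k J = fact (I - 1) / fact (k - 1) * tau_circ_dot_at_I N I J
       + real k * sigma_dot N I (Suc k) J * (1 / real k + (\<Sum>i=Suc k..I - 1. 1 / real i))"
      using False neq unfolding * [symmetric] by (simp add: tau_circ_dot_def s)
    moreover have "tau_circ_dot N I (Suc k) J = fact (I - 1) / fact k * tau_circ_dot_at_I N I J
       + sigma_dot N I (Suc k) J * (\<Sum>i=Suc k..I - 1. 1 / real i)"
      using False neq by (simp add: tau_circ_dot_def)
    moreover have "F / c * t + K * s * (1 / K + H) = s + K * (F / (K * c) * t + s * H)"
      if "K \<noteq> 0" "c \<noteq> 0" for F c t K s H :: real
      using that by (simp add: field_simps)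
    ultimately show ?thesis using False assms
      by (simp add: child_mult_def f)
  qed
qed

lemma tau_circ_dot_full: "I < N \<Longrightarrow> 1 \<le> J \<Longrightarrow> tau_circ_dot N I N J = 0"
  by (simp add: tau_circ_dot_def)

lemma sigma_dot_nonneg: "0 \<le> sigma_dot N I k J"
  by (simp add: sigma_dot_def)

section \<open>Closed forms of the acceptance criterion and its inheritance\<close>

lemma Delta_dot_gt:
  assumes "I < k" "j \<le> I + 1"
  shows "dot_R I (Delta_dot N I k j) x = (\<Sum>J=1..j. J_weight N I x k J * gain N k J)"
proof -
  have "dot_R I (Delta_dot N I k j) x = (\<Sum>J=1..j. Delta_dot N I k j J * R_dot I J x)"
    unfolding dot_R_def using assms by (intro sum.mono_neutral_right) (auto simp: Delta_dot_def)
  also have "\<dots> = (\<Sum>J=1..j. J_weight N I x k J * gain N k J)"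
  proof (rule sum.cong)
    fix J assume J: "J \<in> {1..j}"
    then have "k + 1 - J = k - J + 1" using assms by auto
    then show "Delta_dot N I k j J * R_dot I J x = J_weight N I x k J * gain N k J"
      using J assms by (simp add: Delta_dot_def sigma_dot_def tau_circ_dot_def J_weight_def gain_def
          algebra_simps diff_divide_distrib)
  qed simp
  finally show ?thesis .
qed

lemma Delta_dot_le:
  assumes "1 \<le> k" "k \<le> I" "I < N"
  shows "dot_R I (Delta_dot N I k j) x =
    (\<Sum>J=1..I. 1 / fact (k - 1) * real (N choose (J - 1)) * (fact (N - J) * fact (I - 1) / fact (I - J))
       * (1 - (\<Sum>i=k..I-1. 1 / real i) - (\<Sum>i=I+1-J..N-J. 1 / real i))
       * x ^ (J - 1) * (1 - x) ^ (I - (J - 1)))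
    - 1 / fact (k - 1) * (fact N / (real I * real (N - I))) * x ^ I"
proof -
  \<comment> \<open>The formula for sizes below \<open>I\<close> also covers \<open>k = I\<close>:
    the quotient is one and the sum is empty.\<close>
  have tau: "tau_circ_dot N I k J = fact (I - 1) / fact (k - 1) * tau_circ_dot_at_I N I J
       + sigma_dot N I k J * (\<Sum>i=k..I-1. 1 / real i)" for J
  proof (cases "k = I")
    case True
    then have "{k..I-1} = {}" using assms by auto
    then show ?thesis using True by (simp add: tau_circ_dot_def)
  qed (use assms in \<open>simp add: tau_circ_dot_def\<close>)
  have last: "Delta_dot N I k j (Suc I) = - (1 / fact (k - 1) * (fact N / (real I * real (N - I))))"
  proof -
    have "(fact I :: real) = real I * fact (I - 1)" using assms by (simp add: fact_reduce)
    then show ?thesis using assms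
      by (simp add: Delta_dot_def tau sigma_dot_def tau_circ_dot_at_I_def)
  qed
  have "Delta_dot N I k j J * R_dot I J x =
    1 / fact (k - 1) * real (N choose (J - 1)) * (fact (N - J) * fact (I - 1) / fact (I - J))
       * (1 - (\<Sum>i=k..I-1. 1 / real i) - (\<Sum>i=I+1-J..N-J. 1 / real i))
       * x ^ (J - 1) * (1 - x) ^ (I - (J - 1))" if "J \<in> {1..I}" for J
  proof -
    have e: "I + 1 - J = I - J + 1" using that by auto
    show ?thesis
      using that assms unfolding e
      by (simp add: Delta_dot_def tau sigma_dot_def tau_circ_dot_at_I_def R_dot_def field_simps)
  qed
  then show ?thesis
    by (simp add: dot_R_def last R_dot_def[of I "Suc I"])
qed

text \<open>For \<open>k < I\<close>, subtracting the recursions shows that \<open>k\<close> times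
  the sum for the child exceeds the sum for the parent by a nonnegative pairing of
  \<open>sigma_dot\<close>. For \<open>k \<ge> I\<close> the edge inequality applies, with
  \<open>m = I\<close> at \<open>k = I\<close> and the J-statistic of \<open>p\<close>
  above.\<close>

lemma Delta_dot_child_nonneg:
  assumes I: "1 \<le> I" "I < N" "I \<le> (N - I)^2" and x: "0 \<le> x" "x < 1"
    and k: "1 \<le> k" "k < N" and p: "p \<in> permutations_of_set {1..k}" and v: "v \<in> {1..Suc k}"
    and nonneg: "0 \<le> dot_R I (Delta_dot N I k (J_stat I p)) x"
  shows "0 \<le> dot_R I (Delta_dot N I (Suc k) (J_stat I (child p v))) x"
proof (cases "k < I")
  case True
  have "Delta_dot N I k j J = real k * Delta_dot N I (Suc k) j' J - sigma_dot N I (Suc k) J"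
    if "J \<in> {1..I+1}" for j j' J
    using that sigma_dot_Suc[of k N J I] tau_circ_dot_Suc[of k N J I] I k True
    by (simp add: Delta_dot_def child_mult_def algebra_simps)
  then have "dot_R I (Delta_dot N I k j) x =
      (\<Sum>J=1..I+1. (real k * Delta_dot N I (Suc k) j' J - sigma_dot N I (Suc k) J) * R_dot I J x)" for j j'
    unfolding dot_R_def by (intro sum.cong) (use atLeastAtMost_iff in \<open>metis\<close>)+
  then have rec: "dot_R I (Delta_dot N I k j) x =
      real k * dot_R I (Delta_dot N I (Suc k) j') x - (\<Sum>J=1..I+1. sigma_dot N I (Suc k) J * R_dot I J x)" for j j'
    unfolding dot_R_def by (simp only: left_diff_distrib sum_subtractf sum_distrib_left mult.assoc)
  have "0 \<le> (\<Sum>J=1..I+1. sigma_dot N I (Suc k) J * R_dot I J x)"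
    using x by (intro sum_nonneg mult_nonneg_nonneg sigma_dot_nonneg R_dot_nonneg)
  then have "0 \<le> real k * dot_R I (Delta_dot N I (Suc k) (J_stat I (child p v))) x"
    using nonneg rec[of "J_stat I p" "J_stat I (child p v)"] by linarith
  then show ?thesis using k by (simp add: zero_le_mult_iff)
next
  case False
  define j' where "j' = J_stat I (child p v)"
  have j': "1 \<le> j'" "j' \<le> I + 1"
    using J_stat_bounds[OF child_perm[OF p v]] False by (auto simp: j'_def)
  have J: "j' = (if k = I then v else min (J_stat I p) v)"
    using J_stat_child[OF p _ v, of I] False by (simp add: j'_def)
  have "0 \<le> (\<Sum>J=1..j'. J_weight N I x (Suc k) J * gain N (Suc k) J)"
  proof (cases "k = I")
    case True
    have "Delta_dot N I I j J * R_dot I J x = J_weight N I x I J * gain N I J" if "J \<in> {1..I}" for J j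
    proof -
      have "I + 1 - J = I - J + 1" using that by auto
      then show ?thesis
        using that by (simp add: Delta_dot_def sigma_dot_def tau_circ_dot_def tau_circ_dot_at_I_def
          J_weight_def gain_def algebra_simps diff_divide_distrib)
    qed
    \<comment> \<open>At \<open>J = I + 1\<close> only \<open>-\<tau>\<close> is left, so dropping
      this term cannot lower the sum; the remaining terms have the product form of weight and
      gain.\<close>
    moreover have "Delta_dot N I I j (Suc I) * R_dot I (Suc I) x \<le> 0" for j
      using I x by (simp add: Delta_dot_def sigma_dot_def tau_circ_dot_def tau_circ_dot_at_I_def R_dot_def)
    ultimately have "dot_R I (Delta_dot N I I j) x \<le> (\<Sum>J=1..I. J_weight N I x I J * gain N I J)" for j
      by (simp add: dot_R_def)
    with nonneg True have "0 \<le> (\<Sum>J=1..I. J_weight N I x I J * gain N I J)"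
      by (metis order_trans)
    then show ?thesis
      unfolding True using I x k True j' by (intro sum_J_weight_gain_Suc[where m = I]) auto
  next
    case neq: False
    then have Ik: "I < k" using False by simp
    note b = J_stat_bounds[OF p Ik]
    show ?thesis
    proof (rule sum_J_weight_gain_Suc[where m = "J_stat I p"])
      show "0 \<le> (\<Sum>J=1..J_stat I p. J_weight N I x k J * gain N k J)"
        using nonneg Delta_dot_gt[OF Ik] b by simp
    qed (use I x k b j' J neq Ik in auto)
  qed
  then show ?thesis using False j' unfolding j'_def[symmetric] by (subst Delta_dot_gt) auto
qed

text \<open>After exchanging the sums it remains to count, for fixed \<open>J\<close>, the
  non-winnable children whose cut-off retains \<open>J\<close>: all \<open>k\<close> of them for
  \<open>k < I\<close>, otherwise \<open>{J..k}\<close>, or none if \<open>p\<close> has already cut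
  off \<open>J\<close>.\<close>

lemma sum_truncated_child:
  assumes p: "p \<in> permutations_of_set {1..k}"
  shows "(\<Sum>v=1..k. truncated I x f (Suc k) (J_stat I (child p v))) =
    truncated I x (\<lambda>k J. child_mult I k J * f (Suc k) J) k (J_stat I p)"
proof -
  have "(\<Sum>v=1..k. if Suc k > I \<and> J > J_stat I (child p v) then 0 else b) =
      (if k > I \<and> J > J_stat I p then 0 else child_mult I k J * b)" if J: "J \<in> {1..I+1}" for J and b :: real
  proof -
    let ?P = "\<lambda>v. Suc k > I \<and> J > J_stat I (child p v)"
    have "(\<Sum>v=1..k. if ?P v then 0 else b) = (\<Sum>v \<in> {v\<in>{1..k}. \<not> ?P v}. b)"
      by (subst sum.inter_filter) (auto intro!: sum.cong)
    also have "\<dots> = real (card {v\<in>{1..k}. \<not> ?P v}) * b" by simp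
    also have "{v\<in>{1..k}. \<not> ?P v} =
        (if k < I then {1..k} else if k > I \<and> J > J_stat I p then {} else {J..k})"
      using J_stat_child[OF p, of I] J by (auto simp: not_less split: if_splits)
    finally show ?thesis by (auto simp: child_mult_def)
  qed
  then show ?thesis
    unfolding truncated_def dot_R_def
    by (subst sum.swap) (auto simp: simp flip: sum_distrib_right intro!: sum.cong)
qed


section \<open>Values of strategies\<close>

lemma winnable_prefix_flattening:
  assumes "distinct w" "1 \<le> i" "i \<le> length w"
  shows "winnable (prefix_flattening i w) \<longleftrightarrow> (\<forall>u\<in>set (take i w). u \<le> entry w i)"
proof -
  have "entry (prefix_flattening i w) i = card {u \<in> set (take i w). u \<le> entry w i}"
    using assms by (simp add: prefix_flattening_def flatten_def entry_def)
  moreover have "length (prefix_flattening i w) = card (set (take i w))"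
    using assms by (simp add: prefix_flattening_def distinct_card)
  moreover have "length (prefix_flattening i w) = i"
    using assms by (simp add: prefix_flattening_def)
  ultimately have "winnable (prefix_flattening i w) \<longleftrightarrow>
      card {u \<in> set (take i w). u \<le> entry w i} = card (set (take i w))"
    by (simp add: winnable_def)
  also have "\<dots> \<longleftrightarrow> {u \<in> set (take i w). u \<le> entry w i} = set (take i w)"
    using card_subset_eq[of "set (take i w)" "{u \<in> set (take i w). u \<le> entry w i}"] by auto
  finally show ?thesis by auto
qed

text \<open>A prefix is winnable when its last entry is a record, that is, a left-to-right maximum.
  So no record follows position \<open>k\<close>, which itself may or may not be one.\<close>

definition last_record :: "nat \<Rightarrow> nat \<Rightarrow> nat list \<Rightarrow> bool" where
  "last_record N k w \<longleftrightarrow> (\<forall>i\<in>{k<..N}. \<not> winnable (prefix_flattening i w))"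

text \<open>The value \<open>N\<close> sits at the last record: its position is a record, and no
  later entry can exceed \<open>N\<close>.\<close>

lemma entry_eq_max_iff:
  assumes w: "w \<in> permutations_of_set {1..N}" and k: "1 \<le> k" "k \<le> N"
  shows "entry w k = N \<longleftrightarrow> winnable (prefix_flattening k w) \<and> last_record N k w"
proof -
  note W = perm_atLeastAtMostD[OF w]
  have win: "winnable (prefix_flattening i w) \<longleftrightarrow> (\<forall>u\<in>set (take i w). u \<le> entry w i)"
    if "1 \<le> i" "i \<le> N" for i
    using winnable_prefix_flattening[of w i] W that by simp
  have le: "u \<le> N" if "u \<in> set (take i w)" for u i
    using set_take_subset[of i w] that W by auto
  have mem: "entry w m \<in> set (take i w)" if "1 \<le> m" "m \<le> i" "i \<le> N" for m i
  proof -
    have "take i w ! (m - 1) \<in> set (take i w)" using that W by (intro nth_mem) auto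
    then show ?thesis using that by (simp add: entry_def)
  qed
  have inj: "i = m" if "entry w i = entry w m" "1 \<le> i" "i \<le> N" "1 \<le> m" "m \<le> N" for i m
  proof -
    have "i - 1 < length w" "m - 1 < length w" using that W by auto
    then have "i - 1 = m - 1" using that(1) W by (simp add: entry_def nth_eq_iff_index_eq)
    then show ?thesis using that by auto
  qed
  have "N \<in> set w" using W k by auto
  then obtain n where "n < length w" "w ! n = N" by (auto simp: in_set_conv_nth)
  then obtain m where m: "1 \<le> m" "m \<le> N" "entry w m = N"
    using W by (intro that[of "Suc n"]) (auto simp: entry_def)
  have mw: "winnable (prefix_flattening m w)"
    using m le win by simp
  have no: "last_record N m w"
    unfolding last_record_def
  proof safe
    fix i assume i: "i \<in> {m<..N}" and "winnable (prefix_flattening i w)"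
    then have "N \<le> entry w i" using win[of i] mem[of m i] m by auto
    moreover have "entry w i \<le> N" using mem[of i i] le i m by auto
    ultimately have "entry w i = entry w m" using m by simp
    then have "i = m" by (rule inj) (use i m(1,2) in simp_all)
    then show False using i by simp
  qed
  show ?thesis
  proof
    assume "entry w k = N"
    then have "entry w k = entry w m" using m(3) by simp
    then have "k = m" by (rule inj) (use k m(1,2) in simp_all)
    then show "winnable (prefix_flattening k w) \<and> last_record N k w" using mw no by simp
  next
    assume *: "winnable (prefix_flattening k w) \<and> last_record N k w"
    have "\<not> k < m"
    proof
      assume "k < m"
      then have "m \<in> {k<..N}" using m by simp
      then show False using * mw by (auto simp: last_record_def)
    qed
    moreover have "\<not> m < k"
    proof
      assume "m < k"
      then have "k \<in> {m<..N}" using k by simp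
      then show False using * no by (auto simp: last_record_def)
    qed
    ultimately show "entry w k = N" using m by (simp add: not_less)
  qed
qed

section \<open>Values as sums over extensions, and their closed forms\<close>

locale reselect_game =
  fixes N I :: nat and x :: real
  assumes I: "1 \<le> I" "I < N" and x: "0 \<le> x" "x < 1"
begin

abbreviation weight :: "nat list \<Rightarrow> real" where
  "weight w \<equiv> R_weight N I (J_stat I w) x"

text \<open>This and the next two values are probabilities of joint events, not conditioned on
  meeting \<open>p\<close>, so that they add up over children.\<close>

definition accept_value :: "nat list \<Rightarrow> real" where
  "accept_value p = (\<Sum>w\<in>extensions N p. if entry w (length p) = N then weight w else 0)"

definition last_record_value :: "nat list \<Rightarrow> real" where
  "last_record_value p = (\<Sum>w\<in>extensions N p. if last_record N (length p) w then weight w else 0)"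

text \<open>The strategy is followed from \<open>p\<close> on, as if all earlier candidates had been
  rejected.\<close>

definition strategy_value :: "strategy \<Rightarrow> nat list \<Rightarrow> real" where
  "strategy_value s p = (\<Sum>w\<in>extensions N p.
     if entry w (LEAST i. length p \<le> i \<and> (i = N \<or> s (prefix_flattening i w))) = N then weight w else 0)"

definition sigma_value :: "nat list \<Rightarrow> real" where
  "sigma_value p = truncated I x (sigma_dot N I) (length p) (J_stat I p) / fact N"

definition tau_value :: "nat list \<Rightarrow> real" where
  "tau_value p = truncated I x (tau_circ_dot N I) (length p) (J_stat I p) / fact N"

lemma weight_nonneg: "0 \<le> R_weight N I j x"
  unfolding R_weight_def using x
  by (intro mult_nonneg_nonneg divide_nonneg_nonneg sum_nonneg zero_le_power) simp_all

lemma truncated_cong: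
  assumes "\<And>J. 1 \<le> J \<Longrightarrow> J \<le> I + 1 \<Longrightarrow> f k J = g k J"
  shows "truncated I x f k j = truncated I x g k j"
  unfolding truncated_def dot_R_def using assms by (intro sum.cong) auto

lemma truncated_add:
  "truncated I x (\<lambda>k J. f k J + g k J) k j = truncated I x f k j + truncated I x g k j"
  unfolding truncated_def dot_R_def sum.distrib[symmetric]
  by (intro sum.cong) (auto simp: distrib_right)

text \<open>At size \<open>N\<close> the factorials cancel. With \<open>h = J - 1\<close>, the
  factor \<open>(1 - x) ^ (N - I)\<close> accounts for the difference between the exponents
  \<open>I - h\<close> and \<open>N - h\<close>.\<close>

lemma sigma_value_full:
  assumes w: "w \<in> permutations_of_set {1..N}"
  shows "sigma_value w = weight w"
proof -
  define j where "j = J_stat I w"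
  have j: "1 \<le> j" "j \<le> I + 1" using J_stat_bounds[OF w I(2)] by (simp_all add: j_def)
  have "truncated I x (sigma_dot N I) N j =
      (\<Sum>J=1..I+1. (if N > I \<and> J > j then 0 else sigma_dot N I N J) * R_dot I J x)"
    by (simp add: truncated_def dot_R_def)
  also have "\<dots> = (\<Sum>J=1..j. (if N > I \<and> J > j then 0 else sigma_dot N I N J) * R_dot I J x)"
    using j I by (intro sum.mono_neutral_right) auto
  also have "\<dots> = (\<Sum>J=1..j. real (N choose (J - 1)) * x ^ (J - 1) * (1 - x) ^ (I - (J - 1)))"
    using I by (intro sum.cong) (auto simp: sigma_dot_def R_dot_def)
  also have "\<dots> = (\<Sum>h=0..j-1. real (N choose h) * x ^ h * (1 - x) ^ (I - h))"
    using j by (intro sum.reindex_bij_witness[of _ Suc "\<lambda>J. J - 1"]) auto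
  also have "\<dots> = (\<Sum>h=0..j-1. real (N choose h) * x ^ h * (1 - x) ^ (N - h)) / (1 - x) ^ (N - I)"
    unfolding sum_divide_distrib
  proof (rule sum.cong)
    fix h assume "h \<in> {0..j-1}"
    then have "N - h = (I - h) + (N - I)" using j I by auto
    then have "(1 - x) ^ (N - h) = (1 - x) ^ (I - h) * (1 - x) ^ (N - I)" by (metis power_add)
    then show "real (N choose h) * x ^ h * (1 - x) ^ (I - h) =
        real (N choose h) * x ^ h * (1 - x) ^ (N - h) / (1 - x) ^ (N - I)"
      using x by simp
  qed simp
  finally show ?thesis
    using perm_atLeastAtMostD(3)[OF w] by (simp add: sigma_value_def R_weight_def j_def)
qed

lemma tau_value_full:
  assumes w: "w \<in> permutations_of_set {1..N}"
  shows "tau_value w = 0"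
proof -
  have "truncated I x (tau_circ_dot N I) N j = 0" for j
    unfolding truncated_def dot_R_def using I by (intro sum.neutral) (auto simp: tau_circ_dot_full)
  then show ?thesis using perm_atLeastAtMostD(3)[OF w] by (simp add: tau_value_def)
qed

lemma sigma_value_step:
  assumes k: "1 \<le> k" "k < N" and p: "p \<in> permutations_of_set {1..k}"
  shows "sigma_value p = (\<Sum>v=1..k. sigma_value (child p v))"
proof -
  have "truncated I x (sigma_dot N I) k (J_stat I p) =
      truncated I x (\<lambda>k J. child_mult I k J * sigma_dot N I (Suc k) J) k (J_stat I p)"
    using k I by (intro truncated_cong sigma_dot_Suc) auto
  then show ?thesis
    using perm_atLeastAtMostD(3)[OF p]
    by (simp add: sigma_value_def sum_truncated_child[OF p, symmetric] sum_divide_distrib)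
qed

lemma tau_value_step:
  assumes k: "1 \<le> k" "k < N" and p: "p \<in> permutations_of_set {1..k}"
  shows "tau_value p = (\<Sum>v=1..k. tau_value (child p v)) + sigma_value (child p (Suc k))"
proof -
  have "truncated I x (tau_circ_dot N I) k (J_stat I p) =
      truncated I x (\<lambda>k J. sigma_dot N I (Suc k) J + child_mult I k J * tau_circ_dot N I (Suc k) J) k (J_stat I p)"
    using k I by (intro truncated_cong tau_circ_dot_Suc) auto
  also have "\<dots> = truncated I x (\<lambda>k. sigma_dot N I (Suc k)) k (J_stat I p) +
      truncated I x (\<lambda>k J. child_mult I k J * tau_circ_dot N I (Suc k) J) k (J_stat I p)"
    by (rule truncated_add)
  \<comment> \<open>Appending a record does not tighten the cut-off: for \<open>k > I\<close> the
    J-statistic persists, being at most \<open>I + 1 \<le> k\<close>, and for \<open>k = I\<close>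
    it becomes \<open>I + 1\<close>, which cuts off nothing.\<close>
  also have "truncated I x (\<lambda>k. sigma_dot N I (Suc k)) k (J_stat I p) =
      truncated I x (sigma_dot N I) (Suc k) (J_stat I (child p (Suc k)))"
  proof -
    have "(k > I \<and> J > J_stat I p) = (Suc k > I \<and> J > J_stat I (child p (Suc k)))"
      if "J \<in> {1..I+1}" for J
      using J_stat_child[OF p, of I "Suc k"] J_stat_bounds[OF p, of I] that
      by (auto simp: min_def split: if_splits)
    then show ?thesis
      unfolding truncated_def dot_R_def by (intro sum.cong refl) (simp only:)
  qed
  finally show ?thesis
    using perm_atLeastAtMostD(3)[OF p]
    by (simp add: tau_value_def sigma_value_def sum_truncated_child[OF p, symmetric]
      sum_divide_distrib add_divide_distrib)
qed

text \<open>Both sides are the weight on full permutations and obey the same recursion, since the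
  winnable child contributes nothing when no record may follow. So \<open>\<sigma>\<close> has a
  meaning at non-winnable prefixes too.\<close>

lemma last_record_value:
  assumes "p \<in> permutations_of_set {1..k}" "1 \<le> k" "k \<le> N"
  shows "last_record_value p = sigma_value p"
  using assms
proof (induction rule: prefix_induct)
  case (full p)
  then show ?case
    using perm_atLeastAtMostD(3)[OF full]
    by (simp add: last_record_value_def extensions_full last_record_def sigma_value_full)
next
  case (step k p)
  note len = perm_atLeastAtMostD(3)[OF step.hyps(3)]
  have rec: "last_record N k w \<longleftrightarrow> \<not> winnable (prefix_flattening (Suc k) w) \<and> last_record N (Suc k) w" for w
  proof -
    have "{k<..N} = insert (Suc k) {Suc k<..N}" using step.hyps by auto
    then show ?thesis by (simp add: last_record_def)
  qed
  have "last_record_value p = (\<Sum>v=1..Suc k. \<Sum>w\<in>extensions N (child p v). if last_record N k w then weight w else 0)"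
    unfolding last_record_value_def len by (rule sum_extensions_child) (use step.hyps in auto)
  also have "\<dots> = (\<Sum>v=1..Suc k. if v = Suc k then 0 else last_record_value (child p v))"
    unfolding last_record_value_def
    by (intro sum.cong) (auto simp: rec len extensions_def winnable_child intro!: sum.neutral sum.cong)
  also have "\<dots> = (\<Sum>v=1..k. sigma_value (child p v))"
    using step.IH by (auto intro!: sum.cong)
  finally show ?case using sigma_value_step step.hyps by simp
qed

lemma accept_value:
  assumes p: "p \<in> permutations_of_set {1..k}" and k: "1 \<le> k" "k \<le> N"
  shows "accept_value p = (if winnable p then sigma_value p else 0)"
proof -
  have "entry w (length p) = N \<longleftrightarrow> winnable p \<and> last_record N (length p) w" if "w \<in> extensions N p" for w
    using entry_eq_max_iff[of w N k] that perm_atLeastAtMostD(3)[OF p] k by (simp add: extensions_def)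
  then have "accept_value p =
      (\<Sum>w\<in>extensions N p. if winnable p \<and> last_record N (length p) w then weight w else 0)"
    unfolding accept_value_def by (intro sum.cong) auto
  then show ?thesis
    using last_record_value[OF assms] by (simp add: last_record_value_def)
qed

lemma strategy_value_accept:
  assumes p: "p \<in> permutations_of_set {1..k}" and s: "k = N \<or> s p"
  shows "strategy_value s p = accept_value p"
proof -
  have "(LEAST i. length p \<le> i \<and> (i = N \<or> s (prefix_flattening i w))) = length p"
    if "w \<in> extensions N p" for w
  proof (rule Least_equality)
    have "prefix_flattening (length p) w = p" using that by (simp add: extensions_def)
    then show "length p \<le> length p \<and> (length p = N \<or> s (prefix_flattening (length p) w))"
      using s perm_atLeastAtMostD(3)[OF p] by auto
  qed simp
  then show ?thesis
    unfolding strategy_value_def accept_value_def by (intro sum.cong) auto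
qed

lemma strategy_value_reject:
  assumes p: "p \<in> permutations_of_set {1..k}" and k: "k < N" and s: "\<not> s p"
  shows "strategy_value s p = (\<Sum>v=1..Suc k. strategy_value s (child p v))"
proof -
  note len = perm_atLeastAtMostD(3)[OF p]
  have eq: "(k \<le> i \<and> (i = N \<or> s (prefix_flattening i w))) = (Suc k \<le> i \<and> (i = N \<or> s (prefix_flattening i w)))"
    if "w \<in> extensions N p" for w i
  proof (cases "i = k")
    case True
    then show ?thesis using that s k len by (simp add: extensions_def)
  qed auto
  have "strategy_value s p = (\<Sum>w\<in>extensions N p.
     if entry w (LEAST i. Suc k \<le> i \<and> (i = N \<or> s (prefix_flattening i w))) = N then weight w else 0)"
    unfolding strategy_value_def len by (intro sum.cong) (simp_all only: eq)
  also have "\<dots> = (\<Sum>v=1..Suc k. strategy_value s (child p v))"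
    unfolding strategy_value_def by (subst sum_extensions_child[OF p k]) (simp add: len)
  finally show ?thesis .
qed

text \<open>For the strategy that takes the first winnable prefix, the recursion at a rejected
  prefix is that of \<open>tau_value\<close>: the winnable child contributes
  \<open>\<sigma>\<close>, the others \<open>\<tau>\<close>.\<close>

lemma strategy_value_winnable:
  assumes "p \<in> permutations_of_set {1..k}" "1 \<le> k" "k \<le> N"
  shows "strategy_value winnable p = (if winnable p then sigma_value p else tau_value p)"
  using assms
proof (induction rule: prefix_induct)
  case (full p)
  then show ?case
    using strategy_value_accept[OF full] accept_value[OF full] I by (simp add: tau_value_full)
next
  case (step k p)
  show ?case
  proof (cases "winnable p")
    case True
    then show ?thesis
      using strategy_value_accept[OF step.hyps(3)] accept_value[OF step.hyps(3)] step.hyps by simp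
  next
    case False
    have "strategy_value winnable p = (\<Sum>v=1..Suc k. strategy_value winnable (child p v))"
      using strategy_value_reject[OF step.hyps(3,2)] False .
    also have "\<dots> = (\<Sum>v=1..k. tau_value (child p v)) + sigma_value (child p (Suc k))"
      using step.IH perm_atLeastAtMostD(3)[OF step.hyps(3)] by (simp add: winnable_child)
    finally show ?thesis using tau_value_step[OF step.hyps] False by simp
  qed
qed

text \<open>This interprets \<open>\<tau>\<close> at winnable prefixes too, as the value of
  rejecting once and then taking the next winnable prefix.\<close>

lemma sum_strategy_value_winnable_child:
  assumes "1 \<le> k" "k < N" "p \<in> permutations_of_set {1..k}"
  shows "(\<Sum>v=1..Suc k. strategy_value winnable (child p v)) = tau_value p"
proof -
  have "strategy_value winnable (child p v) =
      (if v = Suc k then sigma_value (child p v) else tau_value (child p v))" if "v \<in> {1..Suc k}" for v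
    using strategy_value_winnable[OF child_perm[OF assms(3) that]] assms perm_atLeastAtMostD(3)[OF assms(3)]
    by (simp add: winnable_child)
  then show ?thesis using tau_value_step[OF assms] by simp
qed

section \<open>Optimality of the one-step rule\<close>

definition one_step_good :: "nat list \<Rightarrow> bool" where
  "one_step_good p \<longleftrightarrow> 0 \<le> dot_R I (Delta_dot N I (length p) (J_stat I p)) x"

lemma one_step_good_iff: "one_step_good p \<longleftrightarrow> tau_value p \<le> sigma_value p"
  by (simp add: one_step_good_def dot_R_Delta_dot tau_value_def sigma_value_def divide_le_cancel)

lemma one_step_good_child:
  assumes "I \<le> (N - I)^2" and "1 \<le> k" "k < N" and p: "p \<in> permutations_of_set {1..k}"
    and "v \<in> {1..Suc k}" and "one_step_good p"
  shows "one_step_good (child p v)"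
  using Delta_dot_child_nonneg[of I N x k p v] assms I x perm_atLeastAtMostD(3)[OF p]
  by (simp add: one_step_good_def)

text \<open>All children are good, so by induction rejecting is worth at most
  \<open>tau_value p\<close>. This is the right-hand side at a non-winnable \<open>p\<close> and at
  most \<open>sigma_value p\<close> at a winnable one. Accepting gains \<open>sigma_value p\<close>
  only if \<open>p\<close> is winnable.\<close>

lemma strategy_value_le_winnable:
  assumes "I \<le> (N - I)^2" and "p \<in> permutations_of_set {1..k}" "1 \<le> k" "k \<le> N"
    and "one_step_good p"
  shows "strategy_value s p \<le> strategy_value winnable p"
  using assms(2-)
proof (induction rule: prefix_induct)
  case (full p)
  then show ?case using strategy_value_accept[OF full(1)] by simp
next
  case (step k p)
  have win: "strategy_value winnable p = (if winnable p then sigma_value p else tau_value p)"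
    using strategy_value_winnable[OF step.hyps(3)] step.hyps by simp
  have good: "tau_value p \<le> sigma_value p" using step.prems by (simp add: one_step_good_iff)
  have IH: "(\<Sum>v=1..Suc k. strategy_value s (child p v)) \<le> tau_value p"
    unfolding sum_strategy_value_winnable_child[OF step.hyps, symmetric]
    using step.IH one_step_good_child[OF assms(1) step.hyps _ step.prems] by (intro sum_mono) blast
  show ?case
  proof (cases "s p")
    case True
    have "0 \<le> strategy_value winnable p"
      unfolding strategy_value_def by (intro sum_nonneg) (simp add: weight_nonneg)
    then show ?thesis
      using strategy_value_accept[OF step.hyps(3)] accept_value[OF step.hyps(3)] step.hyps True win
      by (simp split: if_splits)
  next
    case False
    then show ?thesis
      using strategy_value_reject[OF step.hyps(3,2), of s] IH win good by simp
  qed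
qed

text \<open>All descendants of a good prefix are good, so the two strategies decide alike from there
  on.\<close>

lemma strategy_value_one_step_eq_winnable:
  assumes "I \<le> (N - I)^2" and "p \<in> permutations_of_set {1..k}" "1 \<le> k" "k \<le> N"
    and "one_step_good p"
  shows "strategy_value (\<lambda>p. winnable p \<and> one_step_good p) p = strategy_value winnable p"
  using assms(2-)
proof (induction rule: prefix_induct)
  case (full p)
  then show ?case using strategy_value_accept[OF full(1)] by simp
next
  case (step k p)
  let ?s = "\<lambda>p. winnable p \<and> one_step_good p"
  show ?case
  proof (cases "winnable p")
    case True
    then show ?thesis using strategy_value_accept[OF step.hyps(3)] step.prems by simp
  next
    case False
    have "(\<Sum>v=1..Suc k. strategy_value ?s (child p v)) = (\<Sum>v=1..Suc k. strategy_value winnable (child p v))"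
      using step.IH one_step_good_child[OF assms(1) step.hyps _ step.prems] by (intro sum.cong) blast+
    then show ?thesis using strategy_value_reject[OF step.hyps(3,2)] False by simp
  qed
qed

text \<open>At good prefixes the two preceding lemmas apply. Elsewhere the rule rejects, and by
  induction no play after a rejection does better. Accepting gives zero or
  \<open>sigma_value p \<le> tau_value p\<close>, and \<open>tau_value p\<close> is attained by
  rejecting and then taking the next winnable prefix.\<close>

lemma strategy_value_le_one_step:
  assumes "I \<le> (N - I)^2" and "p \<in> permutations_of_set {1..k}" "1 \<le> k" "k \<le> N"
  shows "strategy_value s p \<le> strategy_value (\<lambda>p. winnable p \<and> one_step_good p) p"
  using assms(2-)
proof (induction arbitrary: s rule: prefix_induct)
  case (full p)
  then show ?case using strategy_value_accept[OF full(1)] by simp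
next
  case (step k p)
  let ?s = "\<lambda>p. winnable p \<and> one_step_good p"
  show ?case
  proof (cases "one_step_good p")
    case True
    then show ?thesis
      using strategy_value_le_winnable[OF assms(1) step.hyps(3,1)]
        strategy_value_one_step_eq_winnable[OF assms(1) step.hyps(3,1)] step.hyps by simp
  next
    case bad: False
    \<comment> \<open>Stated for every strategy, as it is applied both to the given one and to
      \<open>winnable\<close>.\<close>
    have sum_le: "(\<Sum>v=1..Suc k. strategy_value s (child p v)) \<le> strategy_value ?s p" for s
      using strategy_value_reject[OF step.hyps(3,2), of ?s] bad step.IH by (simp only: simp_thms) (intro sum_mono, blast)
    show ?thesis
    proof (cases "s p")
      case True
      have "0 \<le> strategy_value ?s p"
        unfolding strategy_value_def by (intro sum_nonneg) (simp add: weight_nonneg)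
      moreover have "sigma_value p \<le> tau_value p"
        using bad by (simp add: one_step_good_iff)
      ultimately show ?thesis
        using strategy_value_accept[OF step.hyps(3), of s] accept_value[OF step.hyps(3)] step.hyps True
          sum_le[of winnable] sum_strategy_value_winnable_child[OF step.hyps] by auto
    next
      case False
      then show ?thesis using strategy_value_reject[OF step.hyps(3,2), of s] sum_le[of s] by simp
    qed
  qed
qed

text \<open>The root of the tree is \<open>[1]\<close>, which every full permutation
  extends.\<close>

lemma win_prob_eq_strategy_value: "win_prob N I x s = strategy_value s [1]"
proof -
  let ?P = "permutations_of_set {1..N}"
  have "emeasure (game_measure N I x) {w \<in> ?P. wins N s w} = (\<Sum>w\<in>{w \<in> ?P. wins N s w}. ennreal (weight w))"
    unfolding game_measure_def by (intro emeasure_point_measure_finite) auto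
  also have "\<dots> = ennreal (\<Sum>w\<in>{w \<in> ?P. wins N s w}. weight w)"
    by (intro sum_ennreal weight_nonneg)
  finally have "win_prob N I x s = (\<Sum>w\<in>{w \<in> ?P. wins N s w}. weight w)"
    by (simp add: win_prob_def measure_def sum_nonneg weight_nonneg)
  also have "\<dots> = (\<Sum>w\<in>?P. if wins N s w then weight w else 0)"
    by (intro sum.inter_filter) simp
  also have "\<dots> = strategy_value s [1]"
    using extensions_singleton[of N] I
    by (simp add: strategy_value_def wins_def stop_position_def)
  finally show ?thesis .
qed

lemma optimal_one_step:
  assumes "I \<le> (N - I)^2"
  shows "optimal_strategy N I x (\<lambda>p. winnable p \<and> one_step_good p)"
proof -
  have "[1] \<in> permutations_of_set {1..1::nat}" by (simp add: permutations_of_set_def)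
  then show ?thesis
    using strategy_value_le_one_step[OF assms, of "[1]" 1] I
    by (simp add: optimal_strategy_def win_prob_eq_strategy_value)
qed

end

theorem theorem6p3:
  fixes N I :: nat and x :: real
  assumes "1 \<le> I" and "I < N"
    and "0 \<le> x" and "x < 1"
    and "real I \<le> real N - sqrt (real N + 5/4) + 1/2"
  shows
    "(\<forall>p\<in>prefixes N. \<forall>k j. k = length p \<and> k > I \<and> j = J_stat I p \<longrightarrow>
        dot_R I (Delta_dot N I k j) x =
          (\<Sum>J=1..j. real (N choose (J - 1)) * (fact (N - J) / fact (k - J))
             * (1 - (\<Sum>i=k+1-J..N-J. 1 / real i))
             * x ^ (J - 1) * (1 - x) ^ (I - (J - 1))))
     \<and>
     (\<forall>p\<in>prefixes N. \<forall>k j. k = length p \<and> k \<le> I \<longrightarrow>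
        dot_R I (Delta_dot N I k j) x =
          (\<Sum>J=1..I. 1 / fact (k - 1) * real (N choose (J - 1))
             * (fact (N - J) * fact (I - 1) / fact (I - J))
             * (1 - (\<Sum>i=k..I-1. 1 / real i) - (\<Sum>i=I+1-J..N-J. 1 / real i))
             * x ^ (J - 1) * (1 - x) ^ (I - (J - 1)))
          - 1 / fact (k - 1) * (fact N / (real I * real (N - I))) * x ^ I)
     \<and>
     optimal_strategy N I x
       (\<lambda>p. winnable p \<and> dot_R I (Delta_dot N I (length p) (J_stat I p)) x \<ge> 0)"
proof (intro conjI ballI allI impI)
  interpret reselect_game N I x
    using assms by unfold_locales
  have "sqrt (real N + 5/4) \<le> real (N - I) + 1/2"
    using assms by (simp add: of_nat_diff)
  \<comment> \<open>Expanding the square gives \<open>I + 1 \<le> (N - I)^2\<close>, which yields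
    the form of the bound used for inheritance.\<close>
  then have "real N + 5/4 \<le> (real (N - I) + 1/2)^2"
    using sqrt_le_D by blast
  then have "real I \<le> (real (N - I))^2"
    using assms by (simp add: power2_eq_square algebra_simps of_nat_diff)
  then have "I \<le> (N - I)^2"
    by (metis of_nat_le_iff of_nat_power)
  from optimal_one_step[OF this]
  show "optimal_strategy N I x
      (\<lambda>p. winnable p \<and> dot_R I (Delta_dot N I (length p) (J_stat I p)) x \<ge> 0)"
    by (simp add: one_step_good_def)
next
  fix p k j assume p: "p \<in> prefixes N" and "k = length p \<and> k > I \<and> j = J_stat I p"
  then have k: "k = length p" "I < k" and j: "j = J_stat I p" by auto
  have "p \<in> permutations_of_set {1..k}"
    using p k perm_atLeastAtMostD(3) by (auto simp: prefixes_def)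
  then have "j \<le> I + 1" using J_stat_bounds(2)[of p k I] k j by simp
  then show "dot_R I (Delta_dot N I k j) x =
      (\<Sum>J=1..j. real (N choose (J - 1)) * (fact (N - J) / fact (k - J))
         * (1 - (\<Sum>i=k+1-J..N-J. 1 / real i)) * x ^ (J - 1) * (1 - x) ^ (I - (J - 1)))"
    using k by (simp add: Delta_dot_gt J_weight_def gain_def R_dot_def mult_ac)
next
  fix p k j assume p: "p \<in> prefixes N" and "k = length p \<and> k \<le> I"
  then have "1 \<le> k" "k \<le> I"
    using perm_atLeastAtMostD(3)[of p] by (auto simp: prefixes_def)
  then show "dot_R I (Delta_dot N I k j) x =
      (\<Sum>J=1..I. 1 / fact (k - 1) * real (N choose (J - 1))
         * (fact (N - J) * fact (I - 1) / fact (I - J))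
         * (1 - (\<Sum>i=k..I-1. 1 / real i) - (\<Sum>i=I+1-J..N-J. 1 / real i))
         * x ^ (J - 1) * (1 - x) ^ (I - (J - 1)))
      - 1 / fact (k - 1) * (fact N / (real I * real (N - I))) * x ^ I"
    using assms by (intro Delta_dot_le)
qed

end
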